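(* Let $(\alpha_n)_{n\in\mathbb{N}}$ be a sequence with $0\le\alpha_n\le\frac1n$. Then for every $f\in C_w^k[0,\infty)$, $$\lim_{n\to\infty}\left\|\mathcal{U}_{n}^{[\alpha_n]}(f;\cdot)-f\right\|_w=0.$$
   Context: For $n\in\mathbb{N}$, $0\le\alpha\le\frac1n$, $x\ge 0$ and a function $f$ on $[0,\infty)$ for which the expression converges absolutely, define $$\mathcal{U}_{n}^{[\alpha]}(f;x)=n\sum_{i=0}^{\infty}(1+n\alpha)^{-x/\alpha}\Big(\alpha+\frac1n\Big)^{-i}\frac{x^{(i,-\alpha)}}{i!}\int_0^\infty e^{-nu}\frac{(nu)^i}{i!}f(u)\,du,$$ with $x^{(0,-\alpha)}=1$ and $x^{(i,-\alpha)}=x(x+\alpha)\cdots(x+(i-1)\alpha)$; for $\alpha=0$ the coefficient is understood as its limit as $\alpha\to0$, namely $e^{-nx}\frac{(nx)^i}{i!}$. Let $w(x)=1+x^2$. $B_w[0,\infty)$ is the set of $f:[0,\infty)\to\mathbb{R}$ with $|f(x)|\le M w(x)$ for all $x\ge0$, for some constant $M>0$ depending on $f$, with norm $\|f\|_w=\sup_{x\ge0}\frac{|f(x)|}{w(x)}$. $C_w[0,\infty)$ is the set of continuous $f\in B_w[0,\infty)$, and $C_w^k[0,\infty)$ is the set of $f\in C_w[0,\infty)$ for which $\lim_{x\to\infty}\frac{|f(x)|}{w(x)}=k_f$ exists and is finite. *)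

theory Defs
  imports "HOL-Analysis.Analysis"
begin

text \<open>
  A function on \<open>[0,\<infty>)\<close> is represented by a total function \<open>real \<Rightarrow> real\<close>; every notion below
  depends only on its values on \<open>{0..}\<close>.
\<close>

definition w :: "real \<Rightarrow> real" where
  "w x = 1 + x\<^sup>2"

definition B_w :: "(real \<Rightarrow> real) set" where
  "B_w = {f. \<exists>M>0. \<forall>x\<ge>0. \<bar>f x\<bar> \<le> M * w x}"

text \<open>
  The supremum is taken in the reals, so \<open>norm_w f\<close> is meaningful only for \<open>f \<in> B_w\<close>.
\<close>

definition norm_w :: "(real \<Rightarrow> real) \<Rightarrow> real" where
  "norm_w f = (SUP x\<in>{0..}. \<bar>f x\<bar> / w x)"

definition C_w :: "(real \<Rightarrow> real) set" where
  "C_w = {f \<in> B_w. continuous_on {0..} f}"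

definition C_w_k :: "(real \<Rightarrow> real) set" where
  "C_w_k = {f \<in> C_w. \<exists>k::real. ((\<lambda>x. \<bar>f x\<bar> / w x) \<longlongrightarrow> k) at_top}"

text \<open>\<open>rising \<alpha> i x\<close> is \<open>x (x + \<alpha>) \<dots> (x + (i - 1) \<alpha>)\<close>, written \<open>x\<^sup>(\<^sup>i\<^sup>,\<^sup>-\<^sup>\<alpha>\<^sup>)\<close>.\<close>

definition rising :: "real \<Rightarrow> nat \<Rightarrow> real \<Rightarrow> real" where
  "rising \<alpha> i x = (\<Prod>j<i. x + real j * \<alpha>)"

text \<open>The value for \<open>\<alpha> = 0\<close> is the limit of the other branch as \<open>\<alpha>\<close> tends to \<open>0\<close> from the right.\<close>

definition U_coeff :: "nat \<Rightarrow> real \<Rightarrow> nat \<Rightarrow> real \<Rightarrow> real" where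
  "U_coeff n \<alpha> i x =
     (if \<alpha> = 0 then exp (- (real n * x)) * (real n * x) ^ i / fact i
      else (1 + real n * \<alpha>) powr (- x / \<alpha>) * (\<alpha> + 1 / real n) powi (- int i)
             * rising \<alpha> i x / fact i)"

definition U_kernel :: "nat \<Rightarrow> nat \<Rightarrow> real \<Rightarrow> real" where
  "U_kernel n i u = exp (- (real n * u)) * (real n * u) ^ i / fact i"

definition U :: "nat \<Rightarrow> real \<Rightarrow> (real \<Rightarrow> real) \<Rightarrow> real \<Rightarrow> real" where
  "U n \<alpha> f x =
     real n * (\<Sum>i. U_coeff n \<alpha> i x * (LBINT u:{0..}. U_kernel n i u * f u))"

text \<open>
  Absolute convergence of the expression defining \<open>U n \<alpha> f x\<close>: without it the series and the
  integrals in \<open>U\<close> take unspecified or default values.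
\<close>

definition U_abs_convergent :: "nat \<Rightarrow> real \<Rightarrow> (real \<Rightarrow> real) \<Rightarrow> real \<Rightarrow> bool" where
  "U_abs_convergent n \<alpha> f x \<longleftrightarrow>
     (\<forall>i. set_integrable lborel {0..} (\<lambda>u. U_kernel n i u * f u)) \<and>
     summable (\<lambda>i. \<bar>U_coeff n \<alpha> i x\<bar> * (LBINT u:{0..}. \<bar>U_kernel n i u * f u\<bar>))"

end

theory Submission
  imports Defs "HOL-Probability.Distributions"
begin

text \<open>
  The coefficients are negative binomial (Poisson if \<open>\<alpha> = 0\<close>) weights and \<open>n\<close> times the kernels are
  Erlang densities, so the operator is positive and its values on quadratic polynomials are
  explicit; they differ from the polynomial by \<open>O(w x / n)\<close>. Writing \<open>f = L w + g\<close> with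
  \<open>g = o(w)\<close>, uniform continuity on compact sets gives
  \<open>\<bar>g u - g x\<bar> \<le> \<epsilon> (w u + w x) + C (u - x)\<^sup>2\<close> for all \<open>u, x \<ge> 0\<close>, a bound by a quadratic
  polynomial in \<open>u\<close> to which positivity applies.
\<close>

definition quad :: "real \<Rightarrow> real \<Rightarrow> real \<Rightarrow> real \<Rightarrow> real" where
  "quad a b c u = a + b * u + c * u\<^sup>2"

text \<open>This is the integral of \<open>quad a b c\<close> against \<open>U_kernel n i\<close>.
  The outer bracket is the mean of \<open>quad a b c\<close> under the Erlang law of shape
  \<open>i + 1\<close> and rate \<open>n\<close>; the final division by \<open>n\<close> appears
  because only \<open>n\<close> times the kernel is a density.\<close>

definition kernel_quad :: "nat \<Rightarrow> real \<Rightarrow> real \<Rightarrow> real \<Rightarrow> nat \<Rightarrow> real" where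
  "kernel_quad n a b c i = (a + b * ((i + 1) / n) + c * ((i + 1) * (i + 2) / n\<^sup>2)) / n"

text \<open>This is the value at \<open>x\<close> of the operator on \<open>quad a b c\<close>; the
  factors after \<open>b\<close> and \<open>c\<close> are its first and second moments.\<close>

definition U_quad :: "nat \<Rightarrow> real \<Rightarrow> real \<Rightarrow> real \<Rightarrow> real \<Rightarrow> real \<Rightarrow> real" where
  "U_quad n \<alpha> a b c x = a + b * (x + 1 / n) + c * (x\<^sup>2 + \<alpha> * x + 4 * x / n + 2 / n\<^sup>2)"

section \<open>Coefficients: positivity and factorial moments\<close>

lemma rising_nonneg: "0 \<le> \<alpha> \<Longrightarrow> 0 \<le> x \<Longrightarrow> 0 \<le> rising \<alpha> i x"
  unfolding rising_def by (intro prod_nonneg) auto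

lemma rising_Suc_shift: "rising \<alpha> (Suc i) x = x * rising \<alpha> i (x + \<alpha>)"
  unfolding rising_def by (subst prod.lessThan_Suc_shift) (simp add: algebra_simps)

lemma rising_eq_pochhammer:
  assumes "\<alpha> \<noteq> 0"
  shows "rising \<alpha> i x = \<alpha> ^ i * pochhammer (x / \<alpha>) i"
proof -
  have "\<alpha> ^ i * pochhammer (x / \<alpha>) i = (\<Prod>j<i. \<alpha> * (x / \<alpha> + real j))"
    unfolding pochhammer_prod prod.distrib atLeast0LessThan by simp
  also have "\<dots> = rising \<alpha> i x"
    unfolding rising_def using assms by (intro prod.cong) (auto simp: field_simps)
  finally show ?thesis by simp
qed

lemma U_coeff_nonneg: "0 \<le> \<alpha> \<Longrightarrow> 0 \<le> x \<Longrightarrow> 0 \<le> U_coeff n \<alpha> i x"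
  unfolding U_coeff_def by (auto intro!: mult_nonneg_nonneg divide_nonneg_nonneg rising_nonneg)

lemma U_kernel_nonneg: "0 \<le> u \<Longrightarrow> 0 \<le> U_kernel n i u"
  unfolding U_kernel_def by simp

text \<open>Both branches of \<^const>\<open>U_coeff\<close> satisfy this recurrence, so all factorial moments
  follow from the total mass.\<close>

lemma U_coeff_Suc:
  assumes "n \<ge> 1" "0 \<le> \<alpha>"
  shows "real (Suc i) * U_coeff n \<alpha> (Suc i) x = real n * x * U_coeff n \<alpha> i (x + \<alpha>)"
proof (cases "\<alpha> = 0")
  case True
  have "real (Suc i) * (t / fact (Suc i)) = t / fact i" for t
    by (simp del: of_nat_Suc)
  then show ?thesis using True by (simp add: U_coeff_def del: of_nat_Suc fact_Suc)
next
  case False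
  have n: "real n > 0" using assms by simp
  have \<alpha>: "\<alpha> > 0" using False assms by simp
  define m where "m = 1 + real n * \<alpha>"
  have m: "m > 0" "\<alpha> + 1 / real n = m / real n"
    using n \<alpha> by (auto simp: m_def field_simps intro: add_pos_pos)
  \<comment> \<open>Shifting \<open>x\<close> by \<open>\<alpha>\<close> costs a factor
    \<open>1 / m\<close>; raising \<open>i\<close> by one costs \<open>n / m\<close>. The quotient
    of the two is the \<open>n\<close> of the recurrence.\<close>
  have 1: "m powr (- (x + \<alpha>) / \<alpha>) = m powr (- x / \<alpha>) / m"
  proof -
    have "- (x + \<alpha>) / \<alpha> = - x / \<alpha> - 1" using \<alpha> by (simp add: field_simps)
    then show ?thesis using m by (simp add: powr_diff)
  qed
  have 2: "(m / real n) powi (- int (Suc i)) = (m / real n) powi (- int i) * (real n / m)"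
    by (simp only: power_int_minus power_int_of_nat power_Suc inverse_mult_distrib inverse_divide mult.commute)
  have "real (Suc i) * U_coeff n \<alpha> (Suc i) x
      = real (Suc i) * (m powr (- x / \<alpha>) * ((m / real n) powi (- int i) * (real n / m))
          * (x * rising \<alpha> i (x + \<alpha>)) / fact (Suc i))"
    unfolding U_coeff_def m(2) m_def[symmetric] 2 rising_Suc_shift using False by simp
  also have "\<dots> = real n * x * (m powr (- x / \<alpha>) / m * (m / real n) powi (- int i)
          * rising \<alpha> i (x + \<alpha>) / fact i)"
    by (simp del: of_nat_Suc)
  also have "\<dots> = real n * x * U_coeff n \<alpha> i (x + \<alpha>)"
    unfolding U_coeff_def m(2) m_def[symmetric] 1 using False by simp
  finally show ?thesis .
qed

text \<open>For \<open>\<alpha> = 0\<close> this is the exponential series. Otherwise it is the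
  binomial series of \<open>(1 - q) powr (- x / \<alpha>)\<close> with
  \<open>q = n * \<alpha> / m\<close>; since \<open>1 - q = 1 / m\<close>, its sum cancels the
  prefactor \<open>m powr (- x / \<alpha>)\<close>.\<close>

lemma U_coeff_sums_1:
  assumes "n \<ge> 1" "0 \<le> \<alpha>"
  shows "(\<lambda>i. U_coeff n \<alpha> i x) sums 1"
proof (cases "\<alpha> = 0")
  case True
  have "(\<lambda>i. exp (- (real n * x)) * ((real n * x) ^ i /\<^sub>R fact i)) sums
      (exp (- (real n * x)) * exp (real n * x))"
    by (intro sums_mult exp_converges)
  then show ?thesis using True by (simp add: U_coeff_def field_simps flip: exp_add)
next
  case False
  have n: "real n > 0" using assms by simp
  have \<alpha>: "\<alpha> > 0" using False assms by simp
  define m where "m = 1 + real n * \<alpha>"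
  define q where "q = real n * \<alpha> / m"
  have m: "m > 0" "\<alpha> + 1 / real n = m / real n"
    using n \<alpha> by (auto simp: m_def field_simps intro: add_pos_pos)
  have q: "\<bar>- q\<bar> < 1" "1 + - q = 1 / m"
    using m n \<alpha> by (auto simp: q_def m_def field_simps)
  have "(\<lambda>i. m powr (- x / \<alpha>) * ((- x / \<alpha> gchoose i) * (- q) ^ i)) sums
      (m powr (- x / \<alpha>) * (1 + - q) powr (- x / \<alpha>))"
    by (intro sums_mult gen_binomial_real q)
  moreover have "m powr (- x / \<alpha>) * (1 + - q) powr (- x / \<alpha>) = 1"
    unfolding q(2) using m by (simp flip: powr_mult)
  moreover have "m powr (- x / \<alpha>) * ((- x / \<alpha> gchoose i) * (- q) ^ i) = U_coeff n \<alpha> i x" for i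
  proof -
    have "(- x / \<alpha> gchoose i) * (- q) ^ i = pochhammer (x / \<alpha>) i / fact i * q ^ i"
    proof -
      \<comment> \<open>The sign from rewriting the binomial coefficient with negative upper
        argument as a Pochhammer symbol cancels that of the powers of \<open>- q\<close>.\<close>
      have "(- 1) ^ i * (- q) ^ i = q ^ i"
        by (simp flip: power_mult_distrib)
      then show ?thesis unfolding gbinomial_pochhammer by simp
    qed
    also have "\<dots> = (m / real n) powi (- int i) * rising \<alpha> i x / fact i"
      unfolding rising_eq_pochhammer[OF False] q_def
      using m n by (simp add: power_int_minus power_mult_distrib field_simps)
    finally show ?thesis
      unfolding U_coeff_def m(2) m_def[symmetric] using False by simp
  qed
  ultimately show ?thesis by simp
qed

lemma U_coeff_mean_sums:
  assumes "n \<ge> 1" "0 \<le> \<alpha>"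
  shows "(\<lambda>i. real i * U_coeff n \<alpha> i x) sums (real n * x)"
proof -
  have "(\<lambda>i. real (Suc i) * U_coeff n \<alpha> (Suc i) x) sums (real n * x * 1)"
    unfolding U_coeff_Suc[OF assms] by (intro sums_mult U_coeff_sums_1 assms)
  \<comment> \<open>The term at index 0 vanishes, so undoing the index shift does not change the
    sum.\<close>
  then show ?thesis by (subst (asm) sums_Suc_iff) simp
qed

text \<open>The recurrence turns the second factorial moment at \<open>x\<close> into the mean at
  \<open>x + \<alpha>\<close>, which is where the factor \<open>x + \<alpha>\<close> comes
  from.\<close>

lemma U_coeff_second_moment_sums:
  assumes "n \<ge> 1" "0 \<le> \<alpha>"
  shows "(\<lambda>i. real i * (real i - 1) * U_coeff n \<alpha> i x) sums (real n ^ 2 * x * (x + \<alpha>))"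
proof -
  have eq: "real (Suc i) * (real (Suc i) - 1) * U_coeff n \<alpha> (Suc i) x
      = real n * x * (real i * U_coeff n \<alpha> i (x + \<alpha>))" for i
  proof -
    have "real (Suc i) * (real (Suc i) - 1) * U_coeff n \<alpha> (Suc i) x
        = real i * (real (Suc i) * U_coeff n \<alpha> (Suc i) x)" by simp
    then show ?thesis unfolding U_coeff_Suc[OF assms] by simp
  qed
  have "(\<lambda>i. real (Suc i) * (real (Suc i) - 1) * U_coeff n \<alpha> (Suc i) x) sums
      (real n * x * (real n * (x + \<alpha>)))"
    unfolding eq by (intro sums_mult U_coeff_mean_sums assms)
  then show ?thesis by (subst (asm) sums_Suc_iff) (simp add: power2_eq_square mult_ac)
qed

lemma U_coeff_kernel_quad_sums:
  assumes "n \<ge> 1" "0 \<le> \<alpha>"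
  shows "(\<lambda>i. U_coeff n \<alpha> i x * kernel_quad n a b c i) sums (U_quad n \<alpha> a b c x / n)"
proof -
  have n: "real n > 0" using assms by simp
  let ?C = "\<lambda>i. U_coeff n \<alpha> i x"
  \<comment> \<open>The weights come from \<open>i + 1\<close> and
    \<open>(i + 1) * (i + 2) = i * (i - 1) + 4 * i + 2\<close>, which express
    \<open>kernel_quad\<close> through factorial moments.\<close>
  have "(\<lambda>i. (a / n + b / n\<^sup>2 + 2 * c / n ^ 3) * ?C i + (b / n\<^sup>2 + 4 * c / n ^ 3) * (real i * ?C i)
        + c / n ^ 3 * (real i * (real i - 1) * ?C i)) sums
      ((a / n + b / n\<^sup>2 + 2 * c / n ^ 3) * 1 + (b / n\<^sup>2 + 4 * c / n ^ 3) * (real n * x)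
        + c / n ^ 3 * (real n ^ 2 * x * (x + \<alpha>)))"
    by (intro sums_add sums_mult U_coeff_sums_1 U_coeff_mean_sums U_coeff_second_moment_sums assms)
  moreover have "(a / n + b / n\<^sup>2 + 2 * c / n ^ 3) * ?C i + (b / n\<^sup>2 + 4 * c / n ^ 3) * (real i * ?C i)
        + c / n ^ 3 * (real i * (real i - 1) * ?C i) = ?C i * kernel_quad n a b c i" for i
    using n unfolding kernel_quad_def
    by (simp add: field_simps power2_eq_square power3_eq_cube)
  moreover have "(a / n + b / n\<^sup>2 + 2 * c / n ^ 3) * 1 + (b / n\<^sup>2 + 4 * c / n ^ 3) * (real n * x)
        + c / n ^ 3 * (real n ^ 2 * x * (x + \<alpha>)) = U_quad n \<alpha> a b c x / n"
    using n unfolding U_quad_def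
    by (simp add: field_simps power2_eq_square power3_eq_cube)
  ultimately show ?thesis by simp
qed

section \<open>Kernel integrals through Erlang moments\<close>

text \<open>\<open>erlang_density i\<close> has shape \<open>i + 1\<close>, so it matches the power
  \<open>i\<close> in the kernel, and it vanishes on the negative axis, which absorbs the
  indicator.\<close>

lemma U_kernel_eq_erlang_density:
  assumes "n \<ge> 1"
  shows "indicator {0..} u *\<^sub>R (U_kernel n i u * t) = erlang_density i (real n) u * t / real n"
  using assms by (simp add: U_kernel_def erlang_density_def indicator_def power_mult_distrib)

lemma has_bochner_integral_erlang_density_power:
  assumes "0 < l"
  shows "has_bochner_integral lborel (\<lambda>u. erlang_density k l u * u ^ i) (fact (k + i) / (fact k * l ^ i))"
proof (rule has_bochner_integral_nn_integral)
  \<comment> \<open>Odd powers are negative for \<open>u < 0\<close>, but the density is zero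
    there.\<close>
  show "AE u in lborel. 0 \<le> erlang_density k l u * u ^ i"
    using assms by (intro AE_I2) (auto simp: erlang_density_def)
qed (use assms nn_integral_erlang_ith_moment[OF assms, of k i] in auto)

lemma has_bochner_integral_kernel_quad:
  assumes "n \<ge> 1"
  shows "has_bochner_integral lborel (\<lambda>u. indicator {0..} u *\<^sub>R (U_kernel n i u * quad a b c u))
           (kernel_quad n a b c i)"
proof -
  have n: "real n > 0" using assms by simp
  let ?E = "erlang_density i (real n)"
  note moment = has_bochner_integral_erlang_density_power[OF n, of i]
  have "has_bochner_integral lborel
      (\<lambda>u. a / n * (?E u * u ^ 0) + b / n * (?E u * u ^ 1) + c / n * (?E u * u ^ 2))
      (a / n * (fact (i + 0) / (fact i * real n ^ 0)) + b / n * (fact (i + 1) / (fact i * real n ^ 1))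
        + c / n * (fact (i + 2) / (fact i * real n ^ 2)))"
    by (intro has_bochner_integral_add has_bochner_integral_mult_right
          moment)
  moreover have "a / n * (fact (i + 0) / (fact i * real n ^ 0)) + b / n * (fact (i + 1) / (fact i * real n ^ 1))
        + c / n * (fact (i + 2) / (fact i * real n ^ 2)) = kernel_quad n a b c i"
    using n unfolding kernel_quad_def by (simp add: field_simps power2_eq_square)
  moreover have "a / n * (?E u * u ^ 0) + b / n * (?E u * u ^ 1) + c / n * (?E u * u ^ 2)
      = indicator {0..} u *\<^sub>R (U_kernel n i u * quad a b c u)" for u
    unfolding U_kernel_eq_erlang_density[OF assms] quad_def
    using n by (simp add: field_simps)
  ultimately show ?thesis by simp
qed

lemma set_borel_measurable_U_kernel_mult:
  assumes "set_borel_measurable lborel {0..} g"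
  shows "(\<lambda>u. indicator {0..} u *\<^sub>R (U_kernel n i u * g u)) \<in> borel_measurable lborel"
proof -
  have "U_kernel n i \<in> borel_measurable lborel"
    unfolding U_kernel_def by measurable
  from borel_measurable_times[OF this assms[unfolded set_borel_measurable_def]]
  show ?thesis by (simp add: mult.left_commute)
qed

lemma set_integrable_U_kernel_mult:
  assumes "n \<ge> 1" "set_borel_measurable lborel {0..} g" "\<And>u. 0 \<le> u \<Longrightarrow> \<bar>g u\<bar> \<le> quad a b c u"
  shows "set_integrable lborel {0..} (\<lambda>u. U_kernel n i u * g u)"
  unfolding set_integrable_def
proof (rule Bochner_Integration.integrable_bound)
  show "integrable lborel (\<lambda>u. indicator {0..} u *\<^sub>R (U_kernel n i u * quad a b c u))"
    using has_bochner_integral_kernel_quad[OF assms(1)] by (rule integrable.intros)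
  have "\<bar>U_kernel n i u * g u\<bar> \<le> \<bar>U_kernel n i u * quad a b c u\<bar>" if "0 \<le> u" for u
    unfolding abs_mult using assms(3)[OF that] by (intro mult_left_mono) auto
  then show "AE u in lborel. norm (indicator {0..} u *\<^sub>R (U_kernel n i u * g u))
      \<le> norm (indicator {0..} u *\<^sub>R (U_kernel n i u * quad a b c u))"
    by (intro AE_I2) (auto simp: indicator_def)
qed (rule set_borel_measurable_U_kernel_mult[OF assms(2)])

text \<open>The kernel is nonnegative, so the pointwise bound can be integrated. The domination is
  applied to the difference \<open>?h\<close>, and the integrals of both quadratics are
  explicit.\<close>

lemma U_kernel_integral_close_to_quad:
  assumes "n \<ge> 1" "set_borel_measurable lborel {0..} g"
    and close: "\<And>u. 0 \<le> u \<Longrightarrow> \<bar>g u - quad a b c u\<bar> \<le> quad a' b' c' u"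
  shows "\<bar>(LBINT u:{0..}. U_kernel n i u * g u) - kernel_quad n a b c i\<bar> \<le> kernel_quad n a' b' c' i"
proof -
  let ?h = "\<lambda>u. g u - quad a b c u"
  have q: "set_integrable lborel {0..} (\<lambda>u. U_kernel n i u * quad p q r u)"
    "(LBINT u:{0..}. U_kernel n i u * quad p q r u) = kernel_quad n p q r i" for p q r
    using has_bochner_integral_kernel_quad[OF assms(1), of i p q r]
    unfolding set_integrable_def set_lebesgue_integral_def
    by (simp_all add: has_bochner_integral_iff)
  have "(\<lambda>u. indicator {0..} u *\<^sub>R quad a b c u) \<in> borel_measurable lborel"
    unfolding quad_def by measurable
  from borel_measurable_diff[OF assms(2)[unfolded set_borel_measurable_def] this]
  have "set_borel_measurable lborel {0..} ?h"
    unfolding set_borel_measurable_def by (simp add: right_diff_distrib)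
  then have h: "set_integrable lborel {0..} (\<lambda>u. U_kernel n i u * ?h u)"
    by (rule set_integrable_U_kernel_mult[OF assms(1) _ close])
  have "(LBINT u:{0..}. U_kernel n i u * g u)
      = (LBINT u:{0..}. U_kernel n i u * ?h u + U_kernel n i u * quad a b c u)"
    by (simp add: algebra_simps)
  also have "\<dots> = (LBINT u:{0..}. U_kernel n i u * ?h u) + kernel_quad n a b c i"
    using set_integral_add(2)[OF h q(1)] unfolding q(2) .
  finally have "(LBINT u:{0..}. U_kernel n i u * g u) - kernel_quad n a b c i
      = (LBINT u:{0..}. U_kernel n i u * ?h u)" by simp
  moreover have "\<bar>LBINT u:{0..}. U_kernel n i u * ?h u\<bar> \<le> (LBINT u:{0..}. \<bar>U_kernel n i u * ?h u\<bar>)"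
    using integral_norm_bound[of lborel "\<lambda>u. indicator {0..} u *\<^sub>R (U_kernel n i u * ?h u)"]
    unfolding set_lebesgue_integral_def by (simp add: abs_mult)
  moreover have "\<dots> \<le> (LBINT u:{0..}. U_kernel n i u * quad a' b' c' u)"
    using close by (intro set_integral_mono set_integrable_abs h q)
      (auto simp: abs_mult U_kernel_nonneg intro!: mult_left_mono)
  ultimately show ?thesis unfolding q(2) by simp
qed

section \<open>Positivity of the operator\<close>

lemma suminf_close_to_sums:
  fixes a b d :: "nat \<Rightarrow> real"
  assumes "b sums B" "d sums D" "\<And>i. \<bar>a i - b i\<bar> \<le> d i"
  shows "summable a" "\<bar>suminf a - B\<bar> \<le> D"
proof -
  have abs: "summable (\<lambda>i. \<bar>a i - b i\<bar>)"
    using assms by (intro summable_comparison_test'[OF sums_summable[OF assms(2)]]) auto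
  then have diff: "summable (\<lambda>i. a i - b i)"
    by (rule summable_rabs_cancel)
  from summable_add[OF this sums_summable[OF assms(1)]] show a: "summable a" by simp
  have "suminf a - B = (\<Sum>i. a i - b i)"
    using suminf_diff[OF a sums_summable[OF assms(1)]] sums_unique[OF assms(1)] by simp
  also have "\<bar>\<dots>\<bar> \<le> (\<Sum>i. \<bar>a i - b i\<bar>)"
    by (rule summable_rabs[OF abs])
  also have "\<dots> \<le> suminf d"
    using assms by (intro suminf_le abs sums_summable[OF assms(2)])
  finally show "\<bar>suminf a - B\<bar> \<le> D"
    using sums_unique[OF assms(2)] by simp
qed

text \<open>Averaging the kernel bounds with the nonnegative coefficients carries a quadratic
  approximation with quadratic error from \<open>g\<close> to the operator. As \<open>x\<close> is
  fixed, the six parameters may depend on it.\<close>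

lemma U_close_to_quad:
  assumes n: "n \<ge> 1" and \<alpha>: "0 \<le> \<alpha>" and x: "0 \<le> x" and g: "set_borel_measurable lborel {0..} g"
    and close: "\<And>u. 0 \<le> u \<Longrightarrow> \<bar>g u - quad a b c u\<bar> \<le> quad a' b' c' u"
  shows "summable (\<lambda>i. U_coeff n \<alpha> i x * (LBINT u:{0..}. U_kernel n i u * g u))"
    and "\<bar>U n \<alpha> g x - U_quad n \<alpha> a b c x\<bar> \<le> U_quad n \<alpha> a' b' c' x"
proof -
  let ?I = "\<lambda>i. LBINT u:{0..}. U_kernel n i u * g u"
  have "\<bar>U_coeff n \<alpha> i x * ?I i - U_coeff n \<alpha> i x * kernel_quad n a b c i\<bar>
      \<le> U_coeff n \<alpha> i x * kernel_quad n a' b' c' i" for i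
    unfolding right_diff_distrib[symmetric] abs_mult abs_of_nonneg[OF U_coeff_nonneg[OF \<alpha> x]]
    by (intro mult_left_mono U_kernel_integral_close_to_quad n g close U_coeff_nonneg \<alpha> x)
  note s = suminf_close_to_sums[OF U_coeff_kernel_quad_sums[OF n \<alpha>] U_coeff_kernel_quad_sums[OF n \<alpha>] this]
  from s(1) show "summable (\<lambda>i. U_coeff n \<alpha> i x * ?I i)" .
  have n0: "real n > 0" using n by simp
  have "U n \<alpha> g x - U_quad n \<alpha> a b c x
      = real n * ((\<Sum>i. U_coeff n \<alpha> i x * ?I i) - U_quad n \<alpha> a b c x / n)"
    unfolding U_def using n0 by (simp add: right_diff_distrib)
  then have "\<bar>U n \<alpha> g x - U_quad n \<alpha> a b c x\<bar>
      = real n * \<bar>(\<Sum>i. U_coeff n \<alpha> i x * ?I i) - U_quad n \<alpha> a b c x / n\<bar>"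
    by (simp add: abs_mult)
  also have "\<dots> \<le> real n * (U_quad n \<alpha> a' b' c' x / n)"
    by (intro mult_left_mono s(2)) simp
  finally show "\<bar>U n \<alpha> g x - U_quad n \<alpha> a b c x\<bar> \<le> U_quad n \<alpha> a' b' c' x"
    using n0 by simp
qed

section \<open>The weight and absolute convergence\<close>

lemma w_pos: "0 < w x"
  unfolding w_def by (intro add_pos_nonneg) auto

lemma w_eq_quad: "M * w x = quad M 0 M x"
  unfolding w_def quad_def by (simp add: algebra_simps)

lemma set_borel_measurable_continuous_on_Ici:
  fixes f :: "real \<Rightarrow> real"
  shows "continuous_on {a..} f \<Longrightarrow> set_borel_measurable lborel {a..} f"
  unfolding set_borel_measurable_def
  using borel_measurable_continuous_on_indicator[of "{a..}" f] by simp

text \<open>Kernel and coefficients are nonnegative, so absolute convergence for \<open>g\<close> is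
  convergence for \<open>\<bar>g\<bar>\<close>, obtained by comparison with the zero
  quadratic.\<close>

lemma U_abs_convergent_if_le_w:
  assumes n: "n \<ge> 1" and \<alpha>: "0 \<le> \<alpha>" and x: "0 \<le> x" and g: "set_borel_measurable lborel {0..} g"
    and le: "\<And>u. 0 \<le> u \<Longrightarrow> \<bar>g u\<bar> \<le> M * w u"
  shows "U_abs_convergent n \<alpha> g x"
proof -
  have abs: "set_borel_measurable lborel {0..} (\<lambda>u. \<bar>g u\<bar>)"
    using borel_measurable_abs[OF g[unfolded set_borel_measurable_def]]
    unfolding set_borel_measurable_def by (simp add: abs_mult)
  have "(LBINT u:{0..}. \<bar>U_kernel n i u * g u\<bar>) = (LBINT u:{0..}. U_kernel n i u * \<bar>g u\<bar>)" for i
    by (intro set_lebesgue_integral_cong) (auto simp: abs_mult U_kernel_nonneg)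
  moreover have "summable (\<lambda>i. U_coeff n \<alpha> i x * (LBINT u:{0..}. U_kernel n i u * \<bar>g u\<bar>))"
    using le by (intro U_close_to_quad(1)[OF n \<alpha> x abs, of 0 0 0 M 0 M]) (simp add: w_eq_quad quad_def)
  ultimately show ?thesis
    unfolding U_abs_convergent_def
    using set_integrable_U_kernel_mult[OF n g, of M 0 M] le
    by (simp add: w_eq_quad U_coeff_nonneg[OF \<alpha> x])
qed

section \<open>A weighted modulus of continuity\<close>

text \<open>Membership only gives a limit \<open>k\<close> of the absolute values, whereas
  subtracting \<open>L * w\<close> needs a signed one. If \<open>k > 0\<close>, then
  \<open>f\<close> has no zeros beyond some point, so by the intermediate value theorem its sign is
  eventually constant.\<close>

lemma C_w_k_tendsto:
  assumes "f \<in> C_w_k"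
  obtains L where "((\<lambda>x. f x / w x) \<longlongrightarrow> L) at_top"
proof -
  obtain k where k: "((\<lambda>x. \<bar>f x\<bar> / w x) \<longlongrightarrow> k) at_top"
    using assms unfolding C_w_k_def by auto
  have cont: "continuous_on {0..} f"
    using assms unfolding C_w_k_def C_w_def by auto
  have abs: "\<bar>f x / w x\<bar> = \<bar>f x\<bar> / w x" for x
    using w_pos[of x] by simp
  have "0 \<le> \<bar>f x\<bar> / w x" for x
    using w_pos[of x] by simp
  then have "0 \<le> k"
    by (intro tendsto_lowerbound[OF k]) simp_all
  then consider "k = 0" | "0 < k" by linarith
  then show thesis
  proof cases
    case 1
    then have "((\<lambda>x. \<bar>f x / w x\<bar>) \<longlongrightarrow> 0) at_top"
      using k unfolding abs by simp
    then have "((\<lambda>x. f x / w x) \<longlongrightarrow> 0) at_top"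
      by (rule tendsto_rabs_zero_cancel)
    then show thesis by (rule that)
  next
    case 2
    then have "\<forall>\<^sub>F x in at_top. 0 < \<bar>f x\<bar> / w x"
      using order_tendstoD(1)[OF k] by simp
    then have "\<forall>\<^sub>F x in at_top. f x \<noteq> 0"
      by eventually_elim auto
    then obtain A where A: "\<And>x. x \<ge> A \<Longrightarrow> f x \<noteq> 0"
      unfolding eventually_at_top_linorder by blast
    define B where "B = max A 0"
    have B: "\<And>x. x \<ge> B \<Longrightarrow> f x \<noteq> 0" "0 \<le> B"
      using A by (auto simp: B_def)
    have sgn: "sgn (f x) = sgn (f B)" if x: "x \<ge> B" for x
    proof (rule ccontr)
      assume ne: "sgn (f x) \<noteq> sgn (f B)"
      have c: "continuous_on {B..x} f"
        by (rule continuous_on_subset[OF cont]) (use B in auto)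
      have nz: "f x \<noteq> 0" "f B \<noteq> 0" using B x by auto
      with ne consider "f B < 0" "0 < f x" | "0 < f B" "f x < 0"
        by (auto simp: sgn_if split: if_splits)
      then have "\<exists>y. B \<le> y \<and> y \<le> x \<and> f y = 0"
        using IVT'[of f B 0 x] IVT2'[of f x 0 B] c x by cases auto
      then show False using B by blast
    qed
    have "((\<lambda>x. sgn (f B) * (\<bar>f x\<bar> / w x)) \<longlongrightarrow> sgn (f B) * k) at_top"
      by (intro tendsto_mult_left k)
    moreover have "\<forall>\<^sub>F x in at_top. sgn (f B) * (\<bar>f x\<bar> / w x) = f x / w x"
      using eventually_ge_at_top[of B]
    proof eventually_elim
      case (elim x)
      show ?case
        using mult_sgn_abs[of "f x"] unfolding sgn[OF elim] by simp
    qed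
    ultimately have "((\<lambda>x. f x / w x) \<longlongrightarrow> sgn (f B) * k) at_top"
      by (rule Lim_transform_eventually)
    then show thesis by (rule that)
  qed
qed

text \<open>The function \<open>g = f - L * w\<close> is small relative to \<open>w\<close> at
  infinity and uniformly continuous on compact intervals. Far out the \<open>\<epsilon>\<close> term
  controls its increments; on a compact interval either \<open>u\<close> and \<open>x\<close> are
  close or their squared distance is bounded below.\<close>

lemma weighted_modulus_bound:
  assumes cont: "continuous_on {0..} f" and L: "((\<lambda>x. f x / w x) \<longlongrightarrow> L) at_top" and \<epsilon>: "0 < \<epsilon>"
  obtains C where "0 \<le> C"
    and "\<And>u x. 0 \<le> u \<Longrightarrow> 0 \<le> x \<Longrightarrow> \<bar>f u - f x - L * (w u - w x)\<bar> \<le> \<epsilon> * (w u + w x) + C * (u - x)\<^sup>2"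
proof -
  define g where "g x = f x - L * w x" for x
  have "\<forall>\<^sub>F x in at_top. \<bar>f x / w x - L\<bar> < \<epsilon>"
    using tendstoD[OF L \<epsilon>] by (simp add: dist_real_def)
  then obtain A' where A': "\<And>x. x \<ge> A' \<Longrightarrow> \<bar>f x / w x - L\<bar> < \<epsilon>"
    unfolding eventually_at_top_linorder by blast
  define A where "A = max A' 0"
  have A: "\<bar>g x\<bar> \<le> \<epsilon> * w x" if "x \<ge> A" for x
  proof -
    have "g x = w x * (f x / w x - L)" using w_pos[of x] by (simp add: g_def field_simps)
    then have "\<bar>g x\<bar> = w x * \<bar>f x / w x - L\<bar>" using w_pos[of x] by (simp add: abs_mult)
    also have "\<dots> \<le> w x * \<epsilon>"
      using A'[of x] that w_pos[of x] by (intro mult_left_mono) (auto simp: A_def)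
    finally show ?thesis by (simp add: mult.commute)
  qed
  have "continuous_on {0..} g"
    unfolding g_def w_def by (intro continuous_intros cont)
  then have c: "continuous_on {0..A + 1} g"
    by (rule continuous_on_subset) auto
  have "bounded (g ` {0..A + 1})"
    by (intro compact_imp_bounded compact_continuous_image c) simp
  then obtain M where "0 < M" and M: "\<And>x. 0 \<le> x \<Longrightarrow> x \<le> A + 1 \<Longrightarrow> \<bar>g x\<bar> \<le> M"
    unfolding bounded_pos by auto
  have "uniformly_continuous_on {0..A + 1} g"
    by (intro compact_uniformly_continuous c) simp
  then obtain d where "0 < d" and d: "\<And>x u. 0 \<le> x \<Longrightarrow> x \<le> A + 1 \<Longrightarrow> 0 \<le> u \<Longrightarrow> u \<le> A + 1
      \<Longrightarrow> \<bar>u - x\<bar> < d \<Longrightarrow> \<bar>g u - g x\<bar> < \<epsilon>"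
    unfolding uniformly_continuous_on_def dist_real_def using \<epsilon> by (metis atLeastAtMost_iff)
  \<comment> \<open>The first summand serves points of \<open>{0..A + 1}\<close> at distance at
    least \<open>d\<close>, where the increment is at most \<open>2 * M\<close>; the second serves a
    point up to \<open>A\<close> and one beyond \<open>A + 1\<close>, at distance at least
    1.\<close>
  define C where "C = 2 * M / d\<^sup>2 + M"
  have "0 \<le> C" using \<open>0 < M\<close> by (simp add: C_def)
  have w1: "1 \<le> w x" for x by (simp add: w_def)
  have MC: "M \<le> C" "2 * M / d\<^sup>2 \<le> C" using \<open>0 < M\<close> by (auto simp: C_def)
  have \<epsilon>w: "\<epsilon> \<le> \<epsilon> * w x" for x using \<epsilon> w1[of x] by simp
  have Csq: "0 \<le> C * (u - x)\<^sup>2" for u x using \<open>0 \<le> C\<close> by simp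
  have mixed: "\<bar>g u\<bar> + \<bar>g x\<bar> \<le> \<epsilon> * w x + C * (u - x)\<^sup>2"
    if "0 \<le> u" "u \<le> A" "A + 1 \<le> x" for u x
  proof -
    have "1 \<le> \<bar>u - x\<bar>" using that by simp
    then have "1 \<le> (u - x)\<^sup>2" by (simp add: abs_le_square_iff[of 1, simplified])
    then have "C * 1 \<le> C * (u - x)\<^sup>2" using \<open>0 \<le> C\<close> by (intro mult_left_mono)
    then show ?thesis using M[of u] A[of x] MC that by simp
  qed
  have "\<bar>g u - g x\<bar> \<le> \<epsilon> * (w u + w x) + C * (u - x)\<^sup>2" if ux: "0 \<le> u" "0 \<le> x" for u x
  proof -
    \<comment> \<open>The compact range up to \<open>A + 1\<close> and the far range from
      \<open>A\<close> overlap, so any remaining pair is separated by at least 1.\<close>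
    consider (near) "u \<le> A + 1" "x \<le> A + 1" "\<bar>u - x\<bar> < d" | (apart) "u \<le> A + 1" "x \<le> A + 1" "d \<le> \<bar>u - x\<bar>"
      | (far) "A \<le> u" "A \<le> x" | (left) "u \<le> A" "A + 1 \<le> x" | (right) "x \<le> A" "A + 1 \<le> u"
      by linarith
    then show ?thesis
    proof cases
      case near
      then show ?thesis
        using d[of x u] ux \<epsilon>w[of u] \<epsilon>w[of x] \<epsilon> Csq[of u x] unfolding distrib_left by linarith
    next
      case apart
      then have "d\<^sup>2 \<le> (u - x)\<^sup>2" using \<open>0 < d\<close> by (metis abs_of_pos abs_le_square_iff)
      then have "2 * M / d\<^sup>2 * d\<^sup>2 \<le> C * (u - x)\<^sup>2"
        using MC \<open>0 < M\<close> \<open>0 \<le> C\<close> by (intro mult_mono) auto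
      then have "2 * M \<le> C * (u - x)\<^sup>2" using \<open>0 < d\<close> by simp
      then show ?thesis
        using M[of u] M[of x] apart ux \<epsilon>w[of u] \<epsilon>w[of x] \<epsilon> unfolding distrib_left by linarith
    next
      case far
      then show ?thesis using A[of u] A[of x] Csq[of u x] unfolding distrib_left by linarith
    next
      case left
      then show ?thesis using mixed[of u x] ux \<epsilon>w[of u] \<epsilon> unfolding distrib_left by linarith
    next
      case right
      then show ?thesis using mixed[of x u] ux \<epsilon>w[of x] \<epsilon>
        unfolding distrib_left power2_commute[of x u] by linarith
    qed
  qed
  moreover have "g u - g x = f u - f x - L * (w u - w x)" for u x
    by (simp add: g_def algebra_simps)
  ultimately show thesis using that[OF \<open>0 \<le> C\<close>] by simp
qed

section \<open>Error estimates for the operator\<close>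

text \<open>The quantity is the excess of the operator's second moment over the square of
  \<open>x\<close>. The condition \<open>\<alpha> \<le> 1 / n\<close> makes it of order
  \<open>1 / n\<close> relative to \<open>w\<close>.\<close>

lemma U_second_moment_error_bounds:
  fixes n :: nat
  assumes n: "n \<ge> 1" and \<alpha>: "0 \<le> \<alpha>" "\<alpha> \<le> 1 / n" and x: "0 \<le> x"
  shows "0 \<le> \<alpha> * x + 4 * x / n + 2 / n\<^sup>2" "\<alpha> * x + 4 * x / n + 2 / n\<^sup>2 \<le> 5 * w x / n"
proof -
  have n0: "real n > 0" "real n \<ge> 1" using n by auto
  show "0 \<le> \<alpha> * x + 4 * x / n + 2 / n\<^sup>2" using \<alpha> x by simp
  have "\<alpha> * x \<le> 1 / n * x" using \<alpha> x by (intro mult_right_mono)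
  moreover have "2 / n\<^sup>2 \<le> 2 / real n"
    using n0 by (simp add: field_simps power2_eq_square)
  ultimately have "\<alpha> * x + 4 * x / n + 2 / n\<^sup>2 \<le> (5 * x + 2) / n"
    by (simp add: add_divide_distrib)
  also have "5 * x + 2 \<le> 5 * w x"
    using zero_le_power2[of "x - 1"] zero_le_power2[of x]
    unfolding w_def power2_diff distrib_left power_one mult_1_right by linarith
  then have "(5 * x + 2) / n \<le> 5 * w x / n" by (simp add: divide_right_mono)
  finally show "\<alpha> * x + 4 * x / n + 2 / n\<^sup>2 \<le> 5 * w x / n" .
qed

text \<open>Comparison with the zero quadratic; the constant is \<open>6 = 1 + 5\<close>, from
  \<open>w\<close> itself and its second moment excess. It puts the error in \<open>B_w\<close>,
  where \<open>norm_w\<close> is meaningful.\<close>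

lemma U_le_w:
  fixes n :: nat
  assumes n: "n \<ge> 1" and \<alpha>: "0 \<le> \<alpha>" "\<alpha> \<le> 1 / n" and x: "0 \<le> x"
    and f: "set_borel_measurable lborel {0..} f" "\<And>u. 0 \<le> u \<Longrightarrow> \<bar>f u\<bar> \<le> M * w u" and M: "0 \<le> M"
  shows "\<bar>U n \<alpha> f x\<bar> \<le> 6 * M * w x"
proof -
  have "\<bar>U n \<alpha> f x - U_quad n \<alpha> 0 0 0 x\<bar> \<le> U_quad n \<alpha> M 0 M x"
    using f(2) by (intro U_close_to_quad(2)[OF n \<alpha>(1) x f(1)]) (simp add: w_eq_quad quad_def)
  also have "\<dots> = M * (w x + (\<alpha> * x + 4 * x / n + 2 / n\<^sup>2))"
    unfolding U_quad_def w_def by (simp add: algebra_simps)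
  also have "\<dots> \<le> M * (w x + 5 * w x)"
  proof (intro mult_left_mono add_left_mono M)
    have "5 * w x / n \<le> 5 * w x / 1"
      using n w_pos[of x] by (intro divide_left_mono) auto
    then show "\<alpha> * x + 4 * x / n + 2 / n\<^sup>2 \<le> 5 * w x"
      using U_second_moment_error_bounds(2)[OF n \<alpha> x] by simp
  qed
  finally show ?thesis by (simp add: U_quad_def)
qed

text \<open>For fixed \<open>x\<close> the hypothesis compares \<open>f\<close> with a quadratic in
  \<open>u\<close> up to a quadratic error, so \<open>U_close_to_quad\<close> applies. The squared
  distance turns into the second central moment, which is at most
  \<open>5 * w x / n\<close>.\<close>

lemma U_error_bound:
  fixes n :: nat
  assumes n: "n \<ge> 1" and \<alpha>: "0 \<le> \<alpha>" "\<alpha> \<le> 1 / n" and x: "0 \<le> x"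
    and f: "set_borel_measurable lborel {0..} f" and \<epsilon>: "0 \<le> \<epsilon>" and C: "0 \<le> C"
    and bound: "\<And>u. 0 \<le> u \<Longrightarrow> \<bar>f u - f x - L * (w u - w x)\<bar> \<le> \<epsilon> * (w u + w x) + C * (u - x)\<^sup>2"
  shows "\<bar>U n \<alpha> f x - f x\<bar> \<le> (7 * \<epsilon> + 5 * (C + \<bar>L\<bar>) / n) * w x"
proof -
  define e where "e = \<alpha> * x + 4 * x / n + 2 / n\<^sup>2"
  have n0: "real n \<ge> 1" using n by simp
  have e: "0 \<le> e" "e \<le> 5 * w x / n"
    using U_second_moment_error_bounds[OF n \<alpha> x] by (auto simp: e_def)
  have "5 * w x / n \<le> 5 * w x / 1"
    using n w_pos[of x] by (intro divide_left_mono) auto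
  then have e5: "e \<le> 5 * w x" using e by simp
  \<comment> \<open>The parameters are the coefficients in \<open>u\<close> of
    \<open>f x + L * (w u - w x)\<close> and of the right-hand side of \<open>bound\<close>.\<close>
  have "\<bar>U n \<alpha> f x - U_quad n \<alpha> (f x - L * x\<^sup>2) 0 L x\<bar>
      \<le> U_quad n \<alpha> (\<epsilon> * (2 + x\<^sup>2) + C * x\<^sup>2) (- 2 * C * x) (\<epsilon> + C) x"
  proof (intro U_close_to_quad(2)[OF n \<alpha>(1) x f])
    fix u :: real
    assume "0 \<le> u"
    from bound[OF this] show "\<bar>f u - quad (f x - L * x\<^sup>2) 0 L u\<bar>
        \<le> quad (\<epsilon> * (2 + x\<^sup>2) + C * x\<^sup>2) (- 2 * C * x) (\<epsilon> + C) u"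
      by (simp add: quad_def w_def power2_eq_square algebra_simps)
  qed
  moreover have "U_quad n \<alpha> (f x - L * x\<^sup>2) 0 L x = f x + L * e"
    by (simp add: U_quad_def e_def algebra_simps)
  \<comment> \<open>The factor of \<open>C\<close> is the second central moment: the excess
    \<open>e\<close> minus \<open>2 * x\<close> times the bias \<open>1 / n\<close> of the
    mean.\<close>
  moreover have "U_quad n \<alpha> (\<epsilon> * (2 + x\<^sup>2) + C * x\<^sup>2) (- 2 * C * x) (\<epsilon> + C) x
      = \<epsilon> * (2 * w x + e) + C * (e - 2 * x / n)"
    by (simp add: U_quad_def e_def w_def power2_eq_square algebra_simps add_divide_distrib)
  ultimately have "\<bar>U n \<alpha> f x - f x - L * e\<bar> \<le> \<epsilon> * (2 * w x + e) + C * (e - 2 * x / n)"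
    by (simp add: algebra_simps)
  moreover have "\<epsilon> * (2 * w x + e) \<le> \<epsilon> * (7 * w x)"
    using e5 \<epsilon> by (intro mult_left_mono) auto
  moreover have "C * (e - 2 * x / n) \<le> C * (5 * w x / n)"
    using e x C by (intro mult_left_mono) (auto intro: order_trans[of _ e])
  moreover have "\<bar>L * e\<bar> \<le> \<bar>L\<bar> * (5 * w x / n)"
    unfolding abs_mult using e by (intro mult_left_mono) auto
  ultimately have "\<bar>U n \<alpha> f x - f x\<bar> \<le> \<epsilon> * (7 * w x) + C * (5 * w x / n) + \<bar>L\<bar> * (5 * w x / n)"
    by linarith
  also have "\<dots> = (7 * \<epsilon> + 5 * (C + \<bar>L\<bar>) / n) * w x"
    using n0 by (simp add: field_simps)
  finally show ?thesis .
qed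

section \<open>The weighted norm and convergence\<close>

lemma norm_w_le:
  assumes "\<And>x. 0 \<le> x \<Longrightarrow> \<bar>f x\<bar> \<le> c * w x"
  shows "norm_w f \<le> c"
  unfolding norm_w_def
proof (rule cSUP_least)
  fix x :: real
  assume "x \<in> {0..}"
  then show "\<bar>f x\<bar> / w x \<le> c"
    using assms[of x] w_pos[of x] by (simp add: divide_le_eq)
qed simp

text \<open>Membership in \<open>B_w\<close> bounds the quotients above, so the supremum is genuine
  and dominates the nonnegative quotient at 0.\<close>

lemma norm_w_nonneg:
  assumes "f \<in> B_w"
  shows "0 \<le> norm_w f"
proof -
  obtain M where M: "\<And>x. 0 \<le> x \<Longrightarrow> \<bar>f x\<bar> \<le> M * w x" using assms unfolding B_w_def by auto
  then have "bdd_above ((\<lambda>x. \<bar>f x\<bar> / w x) ` {0..})"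
    by (intro bdd_aboveI2[of _ _ M]) (simp add: divide_le_eq w_pos)
  then have "\<bar>f 0\<bar> / w 0 \<le> norm_w f"
    unfolding norm_w_def by (intro cSUP_upper) auto
  moreover have "0 \<le> \<bar>f 0\<bar> / w 0"
    using w_pos[of 0] by simp
  ultimately show ?thesis by linarith
qed

text \<open>The first conjunct ensures that, for \<open>n \<ge> 1\<close>, the integrals, series and
  suprema in the limit are genuine rather than default values.\<close>

theorem theorem4p1:
  fixes \<alpha> :: "nat \<Rightarrow> real" and f :: "real \<Rightarrow> real"
  assumes "\<forall>n\<ge>1. 0 \<le> \<alpha> n \<and> \<alpha> n \<le> 1 / real n"
    and "f \<in> C_w_k"
  shows "(\<forall>n\<ge>1. (\<forall>x\<ge>0. U_abs_convergent n (\<alpha> n) f x) \<and> (\<lambda>x. U n (\<alpha> n) f x - f x) \<in> B_w) \<and>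
         (\<lambda>n. norm_w (\<lambda>x. U n (\<alpha> n) f x - f x)) \<longlonglongrightarrow> 0"
proof -
  have cont: "continuous_on {0..} f" and "f \<in> B_w"
    using assms(2) unfolding C_w_k_def C_w_def by auto
  then obtain M where "0 < M" and M: "\<And>u. 0 \<le> u \<Longrightarrow> \<bar>f u\<bar> \<le> M * w u"
    unfolding B_w_def by auto
  note meas = set_borel_measurable_continuous_on_Ici[OF cont]
  have \<alpha>: "0 \<le> \<alpha> n" "\<alpha> n \<le> 1 / real n" if "n \<ge> 1" for n using assms(1) that by auto
  have conv: "U_abs_convergent n (\<alpha> n) f x" if "n \<ge> 1" "0 \<le> x" for n x
    by (rule U_abs_convergent_if_le_w[OF that(1) \<alpha>(1)[OF that(1)] that(2) meas M])
  have B: "(\<lambda>x. U n (\<alpha> n) f x - f x) \<in> B_w" if n: "n \<ge> 1" for n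
  proof -
    have "\<bar>U n (\<alpha> n) f x - f x\<bar> \<le> 7 * M * w x" if x: "0 \<le> x" for x
      using U_le_w[OF n \<alpha>[OF n] x meas M] M[OF x] \<open>0 < M\<close> by linarith
    then show ?thesis unfolding B_w_def using \<open>0 < M\<close> by (auto intro!: exI[of _ "7 * M"])
  qed
  obtain L where L: "((\<lambda>x. f x / w x) \<longlongrightarrow> L) at_top"
    using C_w_k_tendsto[OF assms(2)] .
  have "(\<lambda>n. norm_w (\<lambda>x. U n (\<alpha> n) f x - f x)) \<longlonglongrightarrow> 0"
  proof (rule order_tendstoI)
    fix a :: real
    assume "a < 0"
    show "\<forall>\<^sub>F n in sequentially. a < norm_w (\<lambda>x. U n (\<alpha> n) f x - f x)"
      using eventually_ge_at_top[of 1]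
    proof eventually_elim
      case (elim n)
      then show ?case using norm_w_nonneg[OF B[OF elim]] \<open>a < 0\<close> by linarith
    qed
  next
    fix a :: real
    assume a: "0 < a"
    \<comment> \<open>The error bound carries \<open>7 * \<epsilon>\<close>, so this choice uses up
      \<open>a / 2\<close> and leaves the other half for the term that vanishes as \<open>n\<close>
      grows.\<close>
    then have "0 < a / 14" by simp
    then obtain C where C: "0 \<le> C" and bound: "\<And>u x. 0 \<le> u \<Longrightarrow> 0 \<le> x \<Longrightarrow>
        \<bar>f u - f x - L * (w u - w x)\<bar> \<le> a / 14 * (w u + w x) + C * (u - x)\<^sup>2"
      using weighted_modulus_bound[OF cont L] by metis
    have "(\<lambda>n. 7 * (a / 14) + 5 * (C + \<bar>L\<bar>) / real n) \<longlonglongrightarrow> 7 * (a / 14) + 0"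
      by (intro tendsto_add tendsto_const lim_const_over_n)
    then have "\<forall>\<^sub>F n in sequentially. 7 * (a / 14) + 5 * (C + \<bar>L\<bar>) / real n < a"
      by (rule order_tendstoD(2)) (use a in simp)
    then show "\<forall>\<^sub>F n in sequentially. norm_w (\<lambda>x. U n (\<alpha> n) f x - f x) < a"
      using eventually_ge_at_top[of 1]
    proof eventually_elim
      case (elim n)
      have "norm_w (\<lambda>x. U n (\<alpha> n) f x - f x) \<le> 7 * (a / 14) + 5 * (C + \<bar>L\<bar>) / real n"
        using a by (intro norm_w_le U_error_bound[OF elim(2) \<alpha>[OF elim(2)] _ meas _ C bound]) auto
      then show ?case using elim(1) by linarith
    qed
  qed
  then show ?thesis using conv B by blast
qed

end
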